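(* Let $G$ be a connected $P_5$-free chordal bipartite graph with bipartition $(A,B)$ and $|A|=|B|$. If $c(G-S)\le|S|$ for every non-empty subset $S\subseteq V(G)$, then $G$ has a Hamiltonian cycle.
   Context: Graphs are finite, simple and undirected. A bipartite graph is chordal bipartite if every cycle of length at least six has a chord. $P_5$-free means no induced path on five vertices. For $S\subseteq V(G)$, $c(G-S)$ denotes the number of connected components of the subgraph induced on $V(G)\setminus S$.
   Formalization: The formal theorem additionally assumes that G has at least three vertices; this excludes only the single-edge graph K_2, which satisfies every stated hypothesis but has no Hamiltonian cycle. *)

theory Defs
  imports "Graph_Theory.Graph_Theory"
begin

(* A finite simple undirected graph is the locale predicate graph: a finite symmetric digraph
   without loops and parallel arcs, in which an edge is a pair of opposite arcs. *)

definition bipartition :: "('a, 'b) pre_digraph \<Rightarrow> 'a set \<Rightarrow> 'a set \<Rightarrow> bool" where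
  "bipartition G A B \<longleftrightarrow> A \<union> B = verts G \<and> A \<inter> B = {} \<and>
     (\<forall>u v. u \<rightarrow>\<^bsub>G\<^esub> v \<longrightarrow> u \<in> A \<and> v \<in> B \<or> u \<in> B \<and> v \<in> A)"

(* The predicate pre_digraph.cycle also accepts the closed walk u, v, u along a single edge;
   the length bound excludes it. The length of p is the number of its arcs. *)
definition graph_cycle :: "('a, 'b) pre_digraph \<Rightarrow> 'b awalk \<Rightarrow> bool" where
  "graph_cycle G p \<longleftrightarrow> pre_digraph.cycle G p \<and> 3 \<le> length p"

(* A cycle is a closed walk, so the tails of its arcs are all of its vertices. *)
definition cycle_verts :: "('a, 'b) pre_digraph \<Rightarrow> 'b awalk \<Rightarrow> 'a set" where
  "cycle_verts G p = tail G ` set p"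

definition has_chord :: "('a, 'b) pre_digraph \<Rightarrow> 'b awalk \<Rightarrow> bool" where
  "has_chord G p \<longleftrightarrow> (\<exists>u \<in> cycle_verts G p. \<exists>v \<in> cycle_verts G p. u \<rightarrow>\<^bsub>G\<^esub> v \<and>
     (u, v) \<notin> arc_to_ends G ` set p \<and> (v, u) \<notin> arc_to_ends G ` set p)"

definition chordal_bipartite :: "('a, 'b) pre_digraph \<Rightarrow> bool" where
  "chordal_bipartite G \<longleftrightarrow> graph G \<and> (\<exists>A B. bipartition G A B) \<and>
     (\<forall>p. graph_cycle G p \<and> 6 \<le> length p \<longrightarrow> has_chord G p)"

definition induced_path :: "('a, 'b) pre_digraph \<Rightarrow> 'a list \<Rightarrow> bool" where
  "induced_path G xs \<longleftrightarrow> xs \<noteq> [] \<and> distinct xs \<and> set xs \<subseteq> verts G \<and>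
     (\<forall>i < length xs. \<forall>j < length xs. xs ! i \<rightarrow>\<^bsub>G\<^esub> xs ! j \<longleftrightarrow> j = Suc i \<or> i = Suc j)"

definition P5_free :: "('a, 'b) pre_digraph \<Rightarrow> bool" where
  "P5_free G \<longleftrightarrow> \<not> (\<exists>xs. length xs = 5 \<and> induced_path G xs)"

(* In a symmetric digraph the strongly connected components are the connected components.
   The graph without vertices has none. *)
definition num_components :: "('a, 'b) pre_digraph \<Rightarrow> nat" where
  "num_components G = card (pre_digraph.sccs G)"

definition hamiltonian_cycle :: "('a, 'b) pre_digraph \<Rightarrow> 'b awalk \<Rightarrow> bool" where
  "hamiltonian_cycle G p \<longleftrightarrow> graph_cycle G p \<and> cycle_verts G p = verts G"

end

theory Submission
  imports Defs
begin

text \<open>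
  In a connected \<open>P\<^sub>5\<close>-free bipartite graph, the neighbourhoods of the vertices on either side form
  a chain. Order \<open>A\<close> by increasing degree as \<open>a\<^sub>0, \<dots>, a\<^sub>n\<^sub>-\<^sub>1\<close> and \<open>B\<close> by decreasing degree as
  \<open>b\<^sub>0, \<dots>, b\<^sub>n\<^sub>-\<^sub>1\<close>, so that every neighbourhood of a vertex of \<open>A\<close> is an initial segment of
  the \<open>b\<^sub>j\<close>. For \<open>i < n - 1\<close>, deleting the neighbourhood of \<open>a\<^sub>i\<close> isolates \<open>a\<^sub>0, \<dots>, a\<^sub>i\<close> and
  leaves \<open>a\<^sub>n\<^sub>-\<^sub>1\<close> over, so toughness gives \<open>deg a\<^sub>i \<ge> i + 2\<close>. Hence \<open>a\<^sub>i\<close> is adjacent to \<open>b\<^sub>i\<close> and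
  \<open>b\<^sub>i\<^sub>+\<^sub>1\<close>, and \<open>b\<^sub>0 a\<^sub>0 b\<^sub>1 a\<^sub>1 \<dots> b\<^sub>n\<^sub>-\<^sub>1 a\<^sub>n\<^sub>-\<^sub>1 b\<^sub>0\<close> is a Hamiltonian cycle.
\<close>

section \<open>Nested neighbourhoods in connected \<open>P5_free\<close> bipartite graphs\<close>

definition nbhd :: "('a, 'b) pre_digraph \<Rightarrow> 'a \<Rightarrow> 'a set" where
  "nbhd G v = {w. v \<rightarrow>\<^bsub>G\<^esub> w}"

lemma in_nbhd_iff [simp]: "w \<in> nbhd G v \<longleftrightarrow> v \<rightarrow>\<^bsub>G\<^esub> w"
  by (simp add: nbhd_def)

lemma (in wf_digraph) nbhd_subset_verts: "nbhd G v \<subseteq> verts G"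
  by (auto dest: adj_in_verts)

lemma (in fin_digraph) finite_nbhd: "finite (nbhd G v)"
  using nbhd_subset_verts finite_verts by (rule finite_subset)

lemma bipartition_commute: "bipartition G A B \<Longrightarrow> bipartition G B A"
  by (auto simp: bipartition_def)

lemma bipartition_adj:
  assumes "bipartition G A B" "u \<rightarrow>\<^bsub>G\<^esub> v"
  shows "u \<in> A \<longleftrightarrow> v \<in> B" "u \<in> B \<longleftrightarrow> v \<in> A"
  using assms unfolding bipartition_def by blast+

lemma (in graph) adj_commute: "u \<rightarrow>\<^bsub>G\<^esub> v \<longleftrightarrow> v \<rightarrow>\<^bsub>G\<^esub> u"
  by (metis graph_symmetric)

text \<open>The walk alternates between the two sides, so the only possible chords join
  \<open>x1\<close> to \<open>x4\<close> and \<open>x2\<close> to \<open>x5\<close>. With both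
  excluded, the walk is an induced path.\<close>

lemma (in graph) P5_free_no_path:
  assumes bip: "bipartition G A B" and P5: "P5_free G" and "x1 \<in> A"
    and e: "x1 \<rightarrow>\<^bsub>G\<^esub> x2" "x2 \<rightarrow>\<^bsub>G\<^esub> x3" "x3 \<rightarrow>\<^bsub>G\<^esub> x4" "x4 \<rightarrow>\<^bsub>G\<^esub> x5"
    and ne: "\<not> x1 \<rightarrow>\<^bsub>G\<^esub> x4" "\<not> x2 \<rightarrow>\<^bsub>G\<^esub> x5"
  shows False
proof -
  have e': "x2 \<rightarrow>\<^bsub>G\<^esub> x1" "x3 \<rightarrow>\<^bsub>G\<^esub> x2" "x4 \<rightarrow>\<^bsub>G\<^esub> x3" "x5 \<rightarrow>\<^bsub>G\<^esub> x4"
    "\<not> x4 \<rightarrow>\<^bsub>G\<^esub> x1" "\<not> x5 \<rightarrow>\<^bsub>G\<^esub> x2"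
    using e ne adj_commute by blast+
  have mem: "x1 \<in> A" "x2 \<in> B" "x3 \<in> A" "x4 \<in> B" "x5 \<in> A"
    using \<open>x1 \<in> A\<close> e bipartition_adj[OF bip] by blast+
  have disj: "A \<inter> B = {}" and verts: "A \<union> B = verts G"
    using bip by (auto simp: bipartition_def)
  have nA: "\<not> u \<rightarrow>\<^bsub>G\<^esub> v" if "u \<in> A" "v \<in> A" for u v
    using that disj bipartition_adj[OF bip] by blast
  have nB: "\<not> u \<rightarrow>\<^bsub>G\<^esub> v" if "u \<in> B" "v \<in> B" for u v
    using that disj bipartition_adj[OF bip] by blast
  \<comment> \<open>Identifying two vertices of the same side would turn an edge of the walk into
    one of the two excluded chords.\<close>
  have "x1 \<noteq> x3" "x1 \<noteq> x5" "x3 \<noteq> x5" "x2 \<noteq> x4"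
    using e e' ne by auto
  moreover have "u \<noteq> v" if "u \<in> A" "v \<in> B" for u v
    using that disj by auto
  ultimately have "distinct [x1, x2, x3, x4, x5]"
    using mem by auto
  moreover have "set [x1, x2, x3, x4, x5] \<subseteq> verts G"
    using mem verts by auto
  moreover have "\<forall>i < 5. \<forall>j < 5.
      [x1, x2, x3, x4, x5] ! i \<rightarrow>\<^bsub>G\<^esub> [x1, x2, x3, x4, x5] ! j \<longleftrightarrow> j = Suc i \<or> i = Suc j"
    using e e' ne mem nA nB by (simp add: numeral_eq_Suc All_less_Suc)
  ultimately have "induced_path G [x1, x2, x3, x4, x5]"
    by (simp add: induced_path_def)
  then show False
    using P5 unfolding P5_free_def by (auto dest!: spec[of _ "[x1, x2, x3, x4, x5]"])
qed

text \<open>Distances from \<open>a\<close> are at most three: a walk with four edges has one of the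
  two chords of \<open>P5_free_no_path\<close>, and either chord shortens it to length two.\<close>

lemma (in graph) reachable_cases:
  assumes bip: "bipartition G A B" and P5: "P5_free G" and "a \<in> A" and "a \<rightarrow>\<^sup>* v"
  shows "v = a \<or> a \<rightarrow>\<^bsub>G\<^esub> v \<or> (\<exists>b. a \<rightarrow>\<^bsub>G\<^esub> b \<and> b \<rightarrow>\<^bsub>G\<^esub> v) \<or>
    (\<exists>b c. a \<rightarrow>\<^bsub>G\<^esub> b \<and> b \<rightarrow>\<^bsub>G\<^esub> c \<and> c \<rightarrow>\<^bsub>G\<^esub> v)"
  using \<open>a \<rightarrow>\<^sup>* v\<close>
proof (induction rule: reachable_induct)
  case base
  then show ?case by simp
next
  case (step x y)
  from step.IH consider "x = a" | "a \<rightarrow>\<^bsub>G\<^esub> x" | b where "a \<rightarrow>\<^bsub>G\<^esub> b" "b \<rightarrow>\<^bsub>G\<^esub> x"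
    | b c where "a \<rightarrow>\<^bsub>G\<^esub> b" "b \<rightarrow>\<^bsub>G\<^esub> c" "c \<rightarrow>\<^bsub>G\<^esub> x"
    by blast
  then show ?case
  proof cases
    case 4
    then have "a \<rightarrow>\<^bsub>G\<^esub> x \<or> b \<rightarrow>\<^bsub>G\<^esub> y"
      using P5_free_no_path[OF bip P5 \<open>a \<in> A\<close>] step.hyps by blast
    then show ?thesis using 4 step.hyps by blast
  qed (use step.hyps in blast)+
qed

text \<open>If \<open>a\<close> and \<open>a'\<close> had private neighbours \<open>b\<close> and
  \<open>b'\<close>, then a common neighbour \<open>c\<close> would give the induced path
  \<open>b\<close>, \<open>a\<close>, \<open>c\<close>, \<open>a'\<close>,
  \<open>b'\<close>.\<close>

lemma (in graph) nbhd_chain: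
  assumes bip: "bipartition G A B" and P5: "P5_free G" and conn: "connected G"
    and "a \<in> A" "a' \<in> A"
  shows "nbhd G a \<subseteq> nbhd G a' \<or> nbhd G a' \<subseteq> nbhd G a"
proof (rule ccontr)
  assume "\<not> ?thesis"
  then obtain b b' where b: "a \<rightarrow>\<^bsub>G\<^esub> b" "\<not> a' \<rightarrow>\<^bsub>G\<^esub> b" and b': "a' \<rightarrow>\<^bsub>G\<^esub> b'" "\<not> a \<rightarrow>\<^bsub>G\<^esub> b'"
    unfolding nbhd_def by blast
  have "A \<subseteq> verts G" using bip by (auto simp: bipartition_def)
  then have "a \<rightarrow>\<^sup>* a'"
    using assms symmetric_connected_imp_strongly_connected[OF sym_arcs conn]
    by (auto simp: strongly_connected_def)
  then consider "a' = a" | "a \<rightarrow>\<^bsub>G\<^esub> a'" | c where "a \<rightarrow>\<^bsub>G\<^esub> c" "c \<rightarrow>\<^bsub>G\<^esub> a'"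
    | c d where "a \<rightarrow>\<^bsub>G\<^esub> c" "c \<rightarrow>\<^bsub>G\<^esub> d" "d \<rightarrow>\<^bsub>G\<^esub> a'"
    using reachable_cases[OF bip P5 \<open>a \<in> A\<close>] by blast
  \<comment> \<open>Parity: a walk between two vertices of \<open>A\<close> has even length, so
    distances one and three are impossible.\<close>
  moreover have "\<not> a \<rightarrow>\<^bsub>G\<^esub> a'" "\<And>c d. a \<rightarrow>\<^bsub>G\<^esub> c \<Longrightarrow> c \<rightarrow>\<^bsub>G\<^esub> d \<Longrightarrow> \<not> d \<rightarrow>\<^bsub>G\<^esub> a'"
  proof -
    have "a' \<notin> B"
      using \<open>a' \<in> A\<close> bip by (auto simp: bipartition_def)
    then show "\<not> a \<rightarrow>\<^bsub>G\<^esub> a'" "\<And>c d. a \<rightarrow>\<^bsub>G\<^esub> c \<Longrightarrow> c \<rightarrow>\<^bsub>G\<^esub> d \<Longrightarrow> \<not> d \<rightarrow>\<^bsub>G\<^esub> a'"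
      using \<open>a \<in> A\<close> bipartition_adj[OF bip] by blast+
  qed
  ultimately obtain c where c: "a \<rightarrow>\<^bsub>G\<^esub> c" "c \<rightarrow>\<^bsub>G\<^esub> a'"
    using b b' by blast
  have "b \<in> B" using b \<open>a \<in> A\<close> bipartition_adj[OF bip] by blast
  from P5_free_no_path[OF bipartition_commute[OF bip] P5 this, of a c a' b'] b b' c
  show False by (simp add: adj_commute[of b])
qed

text \<open>Since neighbourhoods form a chain, sorting a side by degree also sorts it by inclusion
  of neighbourhoods.\<close>

lemma (in graph) nbhd_subset_of_card_le:
  assumes "bipartition G A B" "P5_free G" "connected G" "a \<in> A" "a' \<in> A"
    and "card (nbhd G a) \<le> card (nbhd G a')"
  shows "nbhd G a \<subseteq> nbhd G a'"
  using nbhd_chain[OF assms(1-5)]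
proof
  assume "nbhd G a' \<subseteq> nbhd G a"
  then show ?thesis
    using card_seteq[OF finite_nbhd] assms(6) by blast
qed

section \<open>Lower bounds on the number of components\<close>

lemma (in fin_digraph) card_le_num_components:
  assumes "T \<subseteq> verts G"
    and unreach: "\<And>u v. u \<in> T \<Longrightarrow> v \<in> T \<Longrightarrow> u \<rightarrow>\<^sup>* v \<Longrightarrow> u = v"
  shows "card T \<le> num_components G"
proof -
  have "inj_on scc_of T"
  proof (rule inj_onI)
    fix u v assume "u \<in> T" "v \<in> T" "scc_of u = scc_of v"
    moreover from this have "v \<in> scc_of u"
      using in_scc_of_self assms(1) by blast
    ultimately show "u = v"
      using unreach unfolding scc_of_def by blast
  qed
  moreover have "scc_of ` T \<subseteq> sccs_verts"
    using assms(1) scc_of_in_sccs_verts by blast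
  ultimately have "card T \<le> card sccs_verts"
    using card_inj_on_le finite_sccs_verts by blast
  then show ?thesis
    by (simp add: num_components_def card_sccs_verts)
qed

lemma (in wf_digraph) reachable_no_adj:
  assumes "u \<rightarrow>\<^sup>* v" "\<And>w. \<not> u \<rightarrow>\<^bsub>G\<^esub> w"
  shows "v = u"
  using assms(1) by (induction rule: reachable_induct) (use assms(2) in auto)

section \<open>Hamiltonian cycles from cyclic vertex sequences\<close>

lemma (in wf_digraph) awalk_of_vertex_sequence:
  assumes "c 0 \<in> verts G"
    and "\<And>i. i < m \<Longrightarrow> e i \<in> arcs G \<and> tail G (e i) = c i \<and> head G (e i) = c (Suc i)"
  shows "awalk (c 0) (map e [0..<m]) (c m)"
  using assms
proof (induction m)
  case 0
  then show ?case by (simp add: awalk_Nil_iff)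
next
  case (Suc m)
  then have "awalk (c 0) (map e [0..<m]) (c m)"
    by simp
  moreover have "awalk (c m) [e m] (c (Suc m))"
    using Suc.prems(2)[of m] tail_in_verts[of "e m"] by (simp add: awalk_def)
  ultimately show ?case
    by (simp add: awalk_appendI)
qed

text \<open>A cycle is a list of arcs, so an arc \<open>e i\<close> is chosen for each adjacency;
  the tails of these arcs then recover the sequence \<open>c\<close>.\<close>

lemma (in wf_digraph) hamiltonian_cycle_of_vertex_sequence:
  assumes adj: "\<And>i. i < m \<Longrightarrow> c i \<rightarrow>\<^bsub>G\<^esub> c (Suc i)" and closed: "c m = c 0"
    and inj: "inj_on c {..<m}" and onto: "c ` {..<m} = verts G" and "3 \<le> m"
  shows "\<exists>p. hamiltonian_cycle G p"
proof -
  have "\<exists>e. \<forall>i<m. e i \<in> arcs G \<and> tail G (e i) = c i \<and> head G (e i) = c (Suc i)"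
  proof -
    have "\<forall>i. \<exists>x. i < m \<longrightarrow> x \<in> arcs G \<and> tail G x = c i \<and> head G x = c (Suc i)"
      using adj by (force simp: arcs_ends_conv)
    then show ?thesis by metis
  qed
  then obtain e where e: "\<And>i. i < m \<Longrightarrow> e i \<in> arcs G \<and> tail G (e i) = c i \<and> head G (e i) = c (Suc i)"
    by blast
  let ?p = "map e [0..<m]"
  have "c 0 \<in> verts G"
    using onto \<open>3 \<le> m\<close> by auto
  then have walk: "awalk (c 0) ?p (c 0)"
    using awalk_of_vertex_sequence[of c m e] e closed by simp
  have tails: "map (tail G) ?p = map c [0..<m]"
    using e by simp
  \<comment> \<open>The closed walk visits \<open>c 0\<close> first and last; \<open>tl\<close>
    drops the first visit, and what remains must be distinct.\<close>
  have "tl (awalk_verts (c 0) ?p) = map c [1..<m] @ [c 0]"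
  proof -
    have "head G (last ?p) = c 0"
      using e[of "m - 1"] \<open>3 \<le> m\<close> closed by (simp add: last_map)
    then show ?thesis
      using \<open>3 \<le> m\<close> tails by (simp add: awalk_verts_conv upt_rec[of 0])
  qed
  moreover have "distinct (map c [1..<m] @ [c 0])"
  proof -
    have "inj_on c {1..<m}" using inj by (rule inj_on_subset) auto
    moreover have "c 0 \<notin> c ` {1..<m}"
      using inj \<open>3 \<le> m\<close> by (force simp: inj_on_def)
    ultimately show ?thesis by (simp add: distinct_map)
  qed
  ultimately have "cycle ?p"
    using walk \<open>3 \<le> m\<close> by (auto simp: cycle_def)
  moreover have "cycle_verts G ?p = verts G"
  proof -
    have "tail G ` set ?p = set (map (tail G) ?p)" by (simp only: set_map)
    also have "\<dots> = c ` {..<m}" unfolding tails by (simp add: atLeast0LessThan)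
    finally show ?thesis by (simp add: cycle_verts_def onto)
  qed
  ultimately have "hamiltonian_cycle G ?p"
    using \<open>3 \<le> m\<close> by (simp add: hamiltonian_cycle_def graph_cycle_def)
  then show ?thesis ..
qed

section \<open>Degree orderings, toughness and the Hamiltonian cycle\<close>

theorem theorem5:
  fixes G :: "('a, 'b) pre_digraph" and A B :: "'a set"
  assumes "graph G"
    and "3 \<le> card (verts G)"
    and "connected G"
    and "P5_free G"
    and "chordal_bipartite G"
    and "bipartition G A B"
    and "card A = card B"
    and "\<And>S. S \<subseteq> verts G \<Longrightarrow> S \<noteq> {} \<Longrightarrow> num_components (G \<restriction> (verts G - S)) \<le> card S"
  shows "\<exists>p. hamiltonian_cycle G p"
proof -
  interpret graph G by fact
  note P5 = \<open>P5_free G\<close> and bip = \<open>bipartition G A B\<close> and conn = \<open>connected G\<close>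
  note bip' = bipartition_commute[OF bip]
  define n where "n = card A"
  have AB: "A \<union> B = verts G" "A \<inter> B = {}"
    using bip by (auto simp: bipartition_def)
  have fin: "finite A" "finite B"
    using AB(1) finite_verts by (metis finite_Un)+
  have "card (verts G) = n + n"
    using card_Un_disjoint[OF fin AB(2)] \<open>card A = card B\<close> AB(1) n_def by simp
  \<comment> \<open>This rules out the single edge.\<close>
  then have "2 \<le> n"
    using \<open>3 \<le> card (verts G)\<close> by simp
  let ?deg = "\<lambda>v. card (nbhd G v)"

  have ordering: "\<exists>xs. set xs = X \<and> distinct xs \<and> sorted (map f xs)"
    if "finite X" for X :: "'a set" and f :: "'a \<Rightarrow> nat"
  proof -
    from finite_distinct_list[OF that] obtain xs where "set xs = X" "distinct xs" by blast
    then show ?thesis by (intro exI[of _ "sort_key f xs"]) simp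
  qed
  obtain as where as: "set as = A" "distinct as" "sorted (map ?deg as)"
    using ordering[OF fin(1)] by blast
  obtain bs' where bs': "set bs' = B" "distinct bs'" "sorted (map ?deg bs')"
    using ordering[OF fin(2)] by blast
  define bs where "bs = rev bs'"
  have bs: "set bs = B" "distinct bs" "sorted (rev (map ?deg bs))"
    using bs' by (simp_all add: bs_def rev_map)
  have len: "length as = n" "length bs = n"
    using as bs \<open>card A = card B\<close> distinct_card n_def by metis+
  have as_in: "as ! i \<in> A" and bs_in: "bs ! i \<in> B" if "i < n" for i
    using that as(1) bs(1) len nth_mem by metis+
  have as_mono: "nbhd G (as ! i) \<subseteq> nbhd G (as ! j)" if "i \<le> j" "j < n" for i j
  proof (rule nbhd_subset_of_card_le[OF bip P5 conn])
    show "?deg (as ! i) \<le> ?deg (as ! j)"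
      using sorted_nth_mono[OF as(3), of i j] that len by simp
  qed (use that as_in in auto)
  have bs_antimono: "nbhd G (bs ! j) \<subseteq> nbhd G (bs ! i)" if "i \<le> j" "j < n" for i j
  proof (rule nbhd_subset_of_card_le[OF bip' P5 conn])
    show "?deg (bs ! j) \<le> ?deg (bs ! i)"
      using sorted_rev_nth_mono[OF bs(3), of i j] that len by simp
  qed (use that bs_in in auto)
  have nbhd_A: "nbhd G v \<subseteq> B" if "v \<in> A" for v
    using that bipartition_adj[OF bip] by auto

  \<comment> \<open>Toughness speaks only of non-empty sets, and neighbourhoods are the sets to be
    deleted.\<close>
  have nonempty: "nbhd G u \<noteq> {}" if "u \<in> verts G" for u
  proof
    assume "nbhd G u = {}"
    then have "\<And>w. \<not> u \<rightarrow>\<^bsub>G\<^esub> w" by auto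
    moreover have "u \<rightarrow>\<^sup>*\<^bsub>G\<^esub> v" if "v \<in> verts G" for v
      using that \<open>u \<in> verts G\<close> symmetric_connected_imp_strongly_connected[OF sym_arcs conn]
      by (auto simp: strongly_connected_def)
    ultimately have "verts G \<subseteq> {u}"
      using reachable_no_adj by blast
    then have "card (verts G) \<le> card {u}"
      by (rule card_mono[rotated]) simp
    then show False using \<open>3 \<le> card (verts G)\<close> by simp
  qed

  \<comment> \<open>If \<open>as ! i\<close> misses \<open>bs ! j\<close>, it misses every later
    \<open>bs ! k\<close>, whose neighbourhood is smaller; its degree is then at most
    \<open>j\<close>.\<close>
  have adj_initial: "as ! i \<rightarrow>\<^bsub>G\<^esub> bs ! j" if "i < n" "j < n" "j < ?deg (as ! i)" for i j
  proof (rule ccontr)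
    assume not_adj: "\<not> as ! i \<rightarrow>\<^bsub>G\<^esub> bs ! j"
    have "nbhd G (as ! i) \<subseteq> (\<lambda>k. bs ! k) ` {..<j}"
    proof
      fix b assume b: "b \<in> nbhd G (as ! i)"
      then have "b \<in> B" using nbhd_A as_in \<open>i < n\<close> by blast
      then obtain k where k: "k < n" "b = bs ! k"
        using bs(1) len by (metis in_set_conv_nth)
      have "k < j"
      proof (rule ccontr)
        assume "\<not> k < j"
        then have "nbhd G (bs ! k) \<subseteq> nbhd G (bs ! j)" using bs_antimono k by simp
        moreover have "bs ! k \<rightarrow>\<^bsub>G\<^esub> as ! i" using b k adj_commute by simp
        ultimately show False using not_adj adj_commute by auto
      qed
      then show "b \<in> (\<lambda>k. bs ! k) ` {..<j}" using k by blast
    qed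
    then have "?deg (as ! i) \<le> card ((\<lambda>k. bs ! k) ` {..<j})"
      by (rule card_mono[rotated]) simp
    also have "\<dots> \<le> j" using card_image_le[of "{..<j}"] by simp
    finally show False using that by simp
  qed

  have deg_as: "i + 2 \<le> ?deg (as ! i)" if "Suc i < n" for i
  proof -
    define S where "S = nbhd G (as ! i)"
    define H where "H = G \<restriction> (verts G - S)"
    interpret H: sym_digraph H
      unfolding H_def by (rule induced_graph_imp_graph) auto
    interpret H: fin_digraph H
      by (rule H.fin_digraphI) (auto simp: H_def)
    \<comment> \<open>These \<open>i + 2\<close> vertices represent distinct components of
      \<open>H\<close>; \<open>Suc i < n\<close> keeps the last one apart from the others.\<close>
    define T where "T = insert (as ! (n - 1)) ((\<lambda>k. as ! k) ` {..i})"
    have "card T = i + 2"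
    proof -
      have "T = (\<lambda>k. as ! k) ` (insert (n - 1) {..i})" by (simp add: T_def)
      moreover have "inj_on (\<lambda>k. as ! k) (insert (n - 1) {..i})"
        using that as(2) len by (intro inj_on_nth) auto
      ultimately have "card T = card (insert (n - 1) {..i})" by (simp only: card_image)
      then show ?thesis using that by simp
    qed
    moreover have "card T \<le> num_components H"
    proof (rule H.card_le_num_components)
      have "T \<subseteq> A" using that as_in by (auto simp: T_def)
      moreover have "S \<subseteq> B" using that nbhd_A as_in by (simp add: S_def)
      ultimately show "T \<subseteq> verts H" using AB by (auto simp: H_def)
    next
      fix u v assume uv: "u \<in> T" "v \<in> T" and reach: "u \<rightarrow>\<^sup>*\<^bsub>H\<^esub> v"
      have isolated: "\<not> as ! k \<rightarrow>\<^bsub>H\<^esub> w" if "k \<le> i" for k w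
      proof
        assume *: "as ! k \<rightarrow>\<^bsub>H\<^esub> w"
        then have "w \<in> verts H" by (rule H.adj_in_verts)
        then have "w \<notin> S" by (simp add: H_def)
        moreover have "as ! k \<rightarrow>\<^bsub>G\<^esub> w"
          using * by (auto simp: H_def arcs_ends_conv)
        ultimately show False
          using as_mono[of k i] that \<open>Suc i < n\<close> by (auto simp: S_def)
      qed
      \<comment> \<open>At most one of two distinct members of \<open>T\<close> is
        \<open>as ! (n - 1)\<close>. The other is isolated in \<open>H\<close>, and symmetry lets
        the walk start there.\<close>
      have sym: "v \<rightarrow>\<^sup>*\<^bsub>H\<^esub> u"
        using reach by (rule H.symmetric_reachable')
      show "u = v"
        using uv H.reachable_no_adj[OF reach] H.reachable_no_adj[OF sym] isolated
        unfolding T_def by blast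
    qed
    moreover have "num_components H \<le> card S"
      unfolding H_def
    proof (rule assms(8))
      show "S \<subseteq> verts G" by (simp add: S_def nbhd_subset_verts)
      show "S \<noteq> {}" unfolding S_def using nonempty[of "as ! i"] as_in[of i] AB(1) that by auto
    qed
    ultimately show ?thesis by (simp add: S_def)
  qed

  \<comment> \<open>The bound \<open>deg_as\<close> stops before the last vertex. Its neighbourhood
    contains all the others, and every vertex of \<open>B\<close> lies in one of them.\<close>
  have deg_last: "?deg (as ! (n - 1)) = n"
  proof -
    have "B \<subseteq> nbhd G (as ! (n - 1))"
    proof
      fix b assume "b \<in> B"
      then have "nbhd G b \<noteq> {}" using nonempty[of b] AB(1) by blast
      then obtain a where a: "b \<rightarrow>\<^bsub>G\<^esub> a" unfolding nbhd_def by blast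
      then have "a \<in> A" using \<open>b \<in> B\<close> bipartition_adj[OF bip] by blast
      then obtain k where "k < n" "a = as ! k"
        using as(1) len by (metis in_set_conv_nth)
      then have "nbhd G a \<subseteq> nbhd G (as ! (n - 1))"
        using as_mono[of k "n - 1"] by simp
      moreover have "b \<in> nbhd G a"
        using a adj_commute by simp
      ultimately show "b \<in> nbhd G (as ! (n - 1))" ..
    qed
    moreover have "nbhd G (as ! (n - 1)) \<subseteq> B"
      using nbhd_A as_in[of "n - 1"] \<open>2 \<le> n\<close> by simp
    ultimately show ?thesis
      using \<open>card A = card B\<close> n_def by simp
  qed

  have adj_same: "as ! i \<rightarrow>\<^bsub>G\<^esub> bs ! i" if "i < n" for i
  proof (cases "Suc i < n")
    case True
    then show ?thesis using adj_initial[of i i] deg_as[of i] by simp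
  next
    case False
    then have "i = n - 1" using that by simp
    then show ?thesis using adj_initial[of i i] deg_last that by simp
  qed
  \<comment> \<open>The remainder modulo \<open>n\<close> provides the closing edge from the last
    vertex of \<open>as\<close> to \<open>bs ! 0\<close>.\<close>
  have adj_next: "as ! i \<rightarrow>\<^bsub>G\<^esub> bs ! (Suc i mod n)" if "i < n" for i
  proof (cases "Suc i < n")
    case True
    then show ?thesis using adj_initial[of i "Suc i"] deg_as[of i] by simp
  next
    case False
    then have "i = n - 1" "Suc i = n" using that by simp_all
    then show ?thesis using adj_initial[of i 0] deg_last that by simp
  qed

  \<comment> \<open>Even positions run through \<open>bs\<close> and odd ones through
    \<open>as\<close>; \<open>mod n\<close> matters only at position \<open>2 * n\<close>, which
    returns to \<open>bs ! 0\<close>.\<close>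
  define c where "c i = (if even i then bs ! (i div 2 mod n) else as ! (i div 2))" for i
  show ?thesis
  proof (rule hamiltonian_cycle_of_vertex_sequence)
    show "c i \<rightarrow>\<^bsub>G\<^esub> c (Suc i)" if "i < 2 * n" for i
    proof (cases "even i")
      case True
      then obtain k where "i = 2 * k" by blast
      moreover from this have "bs ! k \<rightarrow>\<^bsub>G\<^esub> as ! k"
        using that adj_same[of k] adj_commute by simp
      ultimately show ?thesis using that by (simp add: c_def)
    next
      case False
      then obtain k where "i = 2 * k + 1" by (rule oddE)
      then show ?thesis using that adj_next[of k] by (simp add: c_def)
    qed
    show "c (2 * n) = c 0" by (simp add: c_def)
    show onto: "c ` {..<2 * n} = verts G"
    proof
      show "c ` {..<2 * n} \<subseteq> verts G"
        using as_in bs_in AB(1) \<open>2 \<le> n\<close> by (auto simp: c_def)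
      show "verts G \<subseteq> c ` {..<2 * n}"
      proof
        fix v assume "v \<in> verts G"
        then consider k where "k < n" "v = as ! k" | k where "k < n" "v = bs ! k"
          using AB(1) as(1) bs(1) len by (metis Un_iff in_set_conv_nth)
        then show "v \<in> c ` {..<2 * n}"
        proof cases
          case 1
          then show ?thesis by (intro image_eqI[of _ _ "2 * k + 1"]) (auto simp: c_def)
        next
          case 2
          then show ?thesis by (intro image_eqI[of _ _ "2 * k"]) (auto simp: c_def)
        qed
      qed
    qed
    \<comment> \<open>A map from \<open>2 * n\<close> positions onto \<open>2 * n\<close> vertices
      is injective.\<close>
    show "inj_on c {..<2 * n}"
      using \<open>card (verts G) = n + n\<close> by (intro eq_card_imp_inj_on) (simp_all add: onto)
    show "3 \<le> 2 * n" using \<open>2 \<le> n\<close> by simp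
  qed
qed

end
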